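(* Suppose $d,k,m$ are positive integers. Then there exists $$n(d,k,m)=k+m\binom{d+k}{d}$$ with the following property. Suppose $f:\mathbb C^n\to\mathbb C^m$ is a polynomial map, such that $n\ge n(d,k,m)$, and the coordinate functions of $f$ have degrees $\le d$. Then $f$ maps some $k$-dimensional linear subspace $L\subset\mathbb C^n$ to zero.
   Formalization: The formal theorem adds the hypothesis f(0) = 0, without which the claim fails (a nonzero constant map vanishes on no linear subspace); the conclusion itself forces f(0) = 0. *)

theory Defs
  imports "HOL-Analysis.Analysis"
begin

text \<open>
  A function \<open>g\<close> on \<open>\<complex>\<^sup>n\<close> is polynomial of total degree at most \<open>d\<close> if it is a linear
  combination of monomials \<open>x\<^sup>\<alpha>\<close> with \<open>|\<alpha>| \<le> d\<close>. The zero polynomial is included for every \<open>d\<close>.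
\<close>

definition polynomial_fun_degree_le :: "nat \<Rightarrow> (complex ^ 'n \<Rightarrow> complex) \<Rightarrow> bool" where
  "polynomial_fun_degree_le d g \<longleftrightarrow>
     (\<exists>c :: ('n \<Rightarrow> nat) \<Rightarrow> complex.
        \<forall>x. g x = (\<Sum>\<alpha> | (\<Sum>i\<in>UNIV. \<alpha> i) \<le> d. c \<alpha> * (\<Prod>i\<in>UNIV. (x $ i) ^ \<alpha> i)))"

text \<open>The index set above is finite, so the sum is a genuine one.\<close>

lemma finite_exponents_degree_le:
  "finite {\<alpha> :: 'n::finite \<Rightarrow> nat. (\<Sum>i\<in>UNIV. \<alpha> i) \<le> d}"
proof (rule finite_subset)
  have "\<alpha> j \<le> d" if "(\<Sum>i\<in>UNIV. \<alpha> i) \<le> d" for \<alpha> :: "'n \<Rightarrow> nat" and j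
    using member_le_sum [of j UNIV \<alpha>] that by simp
  then show "{\<alpha> :: 'n \<Rightarrow> nat. (\<Sum>i\<in>UNIV. \<alpha> i) \<le> d} \<subseteq> (UNIV :: 'n set) \<rightarrow>\<^sub>E {..d}"
    by (simp add: subset_iff PiE_iff)
qed (simp add: finite_PiE)

definition polynomial_map_degree_le :: "nat \<Rightarrow> (complex ^ 'n \<Rightarrow> complex ^ 'm) \<Rightarrow> bool" where
  "polynomial_map_degree_le d f \<longleftrightarrow> (\<forall>j. polynomial_fun_degree_le d (\<lambda>x. f x $ j))"

definition n_bound :: "nat \<Rightarrow> nat \<Rightarrow> nat \<Rightarrow> nat" where
  "n_bound d k m = k + m * ((d + k) choose d)"

end

theory Submission
  imports Defs "HOL-Library.Function_Algebras" "HOL-Computational_Algebra.Fundamental_Theorem_Algebra"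
begin

text \<open>
  The subspace is built one dimension at a time. If \<open>f\<close> vanishes on the span of \<open>B\<close>, then \<open>f\<close> vanishes
  on the span of \<open>B\<close> and \<open>x\<close> as soon as \<open>x\<close> is a zero of certain homogeneous polynomials of positive
  degree, obtained by expanding \<open>f (x + \<Sum>\<^sub>v t\<^sub>v v)\<close> in powers of the \<open>t\<^sub>v\<close>; there are at most
  \<open>m ((d + |B| + 1) choose d)\<close> of them. Adding \<open>|B|\<close> linear equations that make \<open>x\<close> orthogonal to \<open>B\<close>
  leaves fewer equations than variables.

  It remains to see that fewer than \<open>n\<close> homogeneous polynomials of positive degree in \<open>n\<close> variables
  have a nontrivial common zero. Otherwise, by the Nullstellensatz, the polynomial ring is a finitely
  generated module over the subring generated by them. This contradicts the growth of dimensions: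
  polynomials of degree at most \<open>n s\<close> take arbitrary values on a grid of \<open>(s + 1)\<^sup>n\<close> points, whereas
  \<open>r\<close> generators only give dimension \<open>O(s\<^sup>r)\<close>.
\<close>

section \<open>Homogeneous polynomial functions\<close>

lemmas fun_apply = plus_fun_apply times_fun_apply zero_fun_apply one_fun_apply minus_apply uminus_apply

(* With these rules active, simp rewrites an eta-expanded p * q to %x. p x * q x, which then no
   longer matches statements about p * q. *)
declare fun_apply [simp del]

lemma sum_fun_apply: "(\<Sum>a\<in>A. f a) x = (\<Sum>a\<in>A. f a x)"
  for f :: "'a \<Rightarrow> 'b \<Rightarrow> 'c::comm_monoid_add"
  by (induction A rule: infinite_finite_induct) (auto simp: fun_apply)

lemma prod_fun_apply: "(\<Prod>a\<in>A. f a) x = (\<Prod>a\<in>A. f a x)"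
  for f :: "'a \<Rightarrow> 'b \<Rightarrow> 'c::comm_monoid_mult"
  by (induction A rule: infinite_finite_induct) (auto simp: fun_apply)

lemma power_fun_apply: "(f ^ n) x = f x ^ n"
  for f :: "'b \<Rightarrow> 'c::comm_monoid_mult"
  by (induction n) (auto simp: fun_apply)

definition coord :: "'n \<Rightarrow> complex ^ 'n \<Rightarrow> complex" where
  "coord i x = x $ i"

text \<open>Homogeneous polynomials are represented as functions generated by constants, sums and
  multiplication by a coordinate, so that facts about them follow by rule induction without
  coefficients. The zero function has every degree, so a missing component can be
  \<open>0\<close>.\<close>

inductive hom :: "nat \<Rightarrow> (complex ^ 'n \<Rightarrow> complex) \<Rightarrow> bool" where
  const: "hom 0 (\<lambda>_. c)"
| zero: "hom e 0"
| add: "hom e p \<Longrightarrow> hom e q \<Longrightarrow> hom e (p + q)"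
| coord: "hom e p \<Longrightarrow> hom (Suc e) (coord i * p)"

lemma hom_coord_self: "hom 1 (coord i)"
  using hom.coord [OF hom.const [of 1], of i] by (simp add: times_fun_def)

lemma hom_scale: "hom e p \<Longrightarrow> hom e ((\<lambda>_. c) * p)"
proof (induction rule: hom.induct)
  case (const c')
  show ?case using hom.const [of "c * c'"] by (simp add: times_fun_def)
next
  case (coord e p i)
  then show ?case using hom.coord [OF coord.IH, of i] by (simp add: mult_ac)
qed (auto intro: hom.intros simp: distrib_left)

lemma hom_mult: "hom a p \<Longrightarrow> hom b q \<Longrightarrow> hom (a + b) (p * q)"
proof (induction rule: hom.induct)
  case (coord e p i)
  then show ?case using hom.coord [of "e + b" "p * q" i] by (simp add: mult_ac)
qed (auto intro: hom.intros hom_scale simp: distrib_right)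

lemma hom_sum: "(\<And>a. a \<in> A \<Longrightarrow> hom e (p a)) \<Longrightarrow> hom e (\<Sum>a\<in>A. p a)"
  by (induction A rule: infinite_finite_induct) (auto intro: hom.intros)

lemma hom_one: "hom 0 1"
  using hom.const [of 1] by (simp add: one_fun_def)

lemma hom_power: "hom a p \<Longrightarrow> hom (a * n) (p ^ n)"
proof (induction n)
  case (Suc n)
  then show ?case using hom_mult [of a p "a * n" "p ^ n"] by simp
qed (simp add: hom_one)

lemma hom_prod:
  "finite A \<Longrightarrow> (\<And>a. a \<in> A \<Longrightarrow> hom (e a) (p a)) \<Longrightarrow> hom (\<Sum>a\<in>A. e a) (\<Prod>a\<in>A. p a)"
  by (induction A rule: finite_induct) (auto intro: hom_mult simp: hom_one)

lemma hom_scaled_arg: "hom e p \<Longrightarrow> p (t *s x) = t ^ e * p x"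
  by (induction rule: hom.induct) (auto simp: coord_def fun_apply algebra_simps)

lemma hom_zero_arg: "hom e p \<Longrightarrow> e > 0 \<Longrightarrow> p 0 = 0"
  using hom_scaled_arg [of e p 0 0] by (simp add: power_0_left)

lemma hom_0_const: "hom e p \<Longrightarrow> e = 0 \<Longrightarrow> p x = p 0"
  \<comment> \<open>In degree 0 the factor \<open>0 ^ 0\<close> is 1, so scaling \<open>x\<close> by
    0 preserves the value.\<close>
  using hom_scaled_arg [of e p 0 x] by simp

section \<open>Expansion along a line and equations for translation invariance\<close>

text \<open>Taylor expansion in direction \<open>v\<close>. The vanishing of \<open>g a\<close>
  beyond \<open>e\<close> carries the induction: multiplying by a coordinate produces a new top
  coefficient in which \<open>g (Suc e)\<close> occurs.\<close>

lemma hom_line_expansion: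
  "hom e p \<Longrightarrow> \<exists>g. (\<forall>a\<le>e. hom (e - a) (g a)) \<and> (\<forall>a>e. g a = 0) \<and>
     (\<forall>x t. p (x + t *s v) = (\<Sum>a\<le>e. t ^ a * g a x))"
proof (induction rule: hom.induct)
  case (const c)
  show ?case
    by (rule exI [of _ "\<lambda>a. if a = 0 then (\<lambda>_. c) else 0"]) (auto intro: hom.intros simp: fun_apply)
next
  case (zero e)
  show ?case
    by (intro exI [of _ "\<lambda>a. 0"] conjI allI impI hom.zero) (simp_all add: fun_apply)
next
  case (add e p q)
  then obtain g h where
    g: "\<forall>a\<le>e. hom (e - a) (g a)" "\<forall>a>e. g a = 0" "\<forall>x t. p (x + t *s v) = (\<Sum>a\<le>e. t ^ a * g a x)" and
    h: "\<forall>a\<le>e. hom (e - a) (h a)" "\<forall>a>e. h a = 0" "\<forall>x t. q (x + t *s v) = (\<Sum>a\<le>e. t ^ a * h a x)"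
    by blast
  show ?case
    by (intro exI [of _ "\<lambda>a. g a + h a"] conjI allI impI hom.add)
       (use g h in \<open>simp_all add: fun_apply distrib_left sum.distrib\<close>)
next
  case (coord e p i)
  then obtain g where
    g: "\<forall>a\<le>e. hom (e - a) (g a)" "\<forall>a>e. g a = 0" "\<forall>x t. p (x + t *s v) = (\<Sum>a\<le>e. t ^ a * g a x)"
    by blast
  \<comment> \<open>Coefficient of \<open>t ^ a\<close> in the product of
    \<open>x $ i + t * v $ i\<close> with the expansion of \<open>p\<close>.\<close>
  define h where "h a = coord i * g a + (\<lambda>_. v $ i) * (if a = 0 then 0 else g (a - 1))" for a
  have "hom (Suc e - a) (h a)" if "a \<le> Suc e" for a
  proof -
    have "hom (Suc e - a) (coord i * g a)"
      using g(1,2) that hom.coord [of "e - a" "g a" i]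
      by (cases "a = Suc e") (auto simp: Suc_diff_le intro: hom.intros)
    moreover have "hom (Suc e - a) ((\<lambda>_. v $ i) * (if a = 0 then 0 else g (a - 1)))"
      using g(1) that by (cases a) (auto intro!: hom_scale intro: hom.intros)
    ultimately show ?thesis unfolding h_def by (rule hom.add)
  qed
  moreover have "h a = 0" if "a > Suc e" for a
    using g(2) that by (auto simp: h_def)
  moreover have "(coord i * p) (x + t *s v) = (\<Sum>a\<le>Suc e. t ^ a * h a x)" for x t
  proof -
    have "(\<Sum>a\<le>Suc e. t ^ a * h a x) = (\<Sum>a\<le>Suc e. t ^ a * (x $ i * g a x))
        + (\<Sum>a\<le>Suc e. t ^ a * (v $ i * (if a = 0 then 0 else g (a - 1) x)))"
      unfolding sum.distrib [symmetric]
      by (rule sum.cong) (auto simp: h_def coord_def fun_apply algebra_simps)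
    also have "(\<Sum>a\<le>Suc e. t ^ a * (x $ i * g a x)) = x $ i * p (x + t *s v)"
      using g(2,3) by (simp add: sum_distrib_left fun_apply mult_ac)
    also have "(\<Sum>a\<le>Suc e. t ^ a * (v $ i * (if a = 0 then 0 else g (a - 1) x)))
        = t * v $ i * p (x + t *s v)"
      using g(3) by (subst sum.atMost_Suc_shift) (simp add: sum_distrib_left mult_ac)
    finally show ?thesis by (simp add: coord_def fun_apply algebra_simps)
  qed
  ultimately show ?case by blast
qed

lemma choose_swap: "(m + n) choose n = (n + m) choose m"
  by (metis add.commute add_diff_cancel_left' binomial_symmetric le_add1)

text \<open>Induction on \<open>B\<close>: expand \<open>g\<close> along the new vector
  \<open>v\<close> and collect the equations for all coefficients. Writing
  \<open>w = u + t *s v\<close> with \<open>u\<close> in the old span, invariance of each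
  coefficient under adding \<open>x\<close> to \<open>u\<close> gives invariance of
  \<open>g\<close>.\<close>

lemma hom_invariance_conditions:
  assumes "finite B" "hom e g"
  shows "\<exists>Q. finite Q \<and> card Q \<le> (e + card B) choose card B \<and>
    (\<forall>q\<in>Q. \<exists>b>0. hom b q) \<and>
    (\<forall>x. (\<forall>q\<in>Q. q x = 0) \<longrightarrow> (\<forall>w\<in>vec.span B. g (x + w) = g w))"
  using assms
proof (induction B arbitrary: e g rule: finite_induct)
  case empty
  \<comment> \<open>The span is zero, so only \<open>g x = g 0\<close> is required: automatic in
    degree 0, and the single equation \<open>g x = 0\<close> in positive degree.\<close>
  show ?case
  proof (cases "e = 0")
    case True
    then show ?thesis
      using hom_0_const [OF empty] by (intro exI [of _ "{}"]) auto
  next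
    case False
    then show ?thesis
      using empty hom_zero_arg [OF empty] by (intro exI [of _ "{g}"]) auto
  qed
next
  case (insert v B)
  obtain g' where "\<forall>a\<le>e. hom (e - a) (g' a)"
    and "\<forall>x t. g (x + t *s v) = (\<Sum>a\<le>e. t ^ a * g' a x)"
    using hom_line_expansion [OF \<open>hom e g\<close>] by blast
  then have g': "\<And>a. a \<le> e \<Longrightarrow> hom (e - a) (g' a)"
    and g'_sum: "\<And>x t. g (x + t *s v) = (\<Sum>a\<le>e. t ^ a * g' a x)"
    by simp_all
  have "\<forall>a. \<exists>Q. a \<le> e \<longrightarrow> finite Q \<and> card Q \<le> (e - a + card B) choose card B \<and>
    (\<forall>q\<in>Q. \<exists>b>0. hom b q) \<and>
    (\<forall>x. (\<forall>q\<in>Q. q x = 0) \<longrightarrow> (\<forall>w\<in>vec.span B. g' a (x + w) = g' a w))"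
  proof
    fix a
    show "\<exists>Q. a \<le> e \<longrightarrow> finite Q \<and> card Q \<le> (e - a + card B) choose card B \<and>
      (\<forall>q\<in>Q. \<exists>b>0. hom b q) \<and>
      (\<forall>x. (\<forall>q\<in>Q. q x = 0) \<longrightarrow> (\<forall>w\<in>vec.span B. g' a (x + w) = g' a w))"
    proof (cases "a \<le> e")
      case True
      show ?thesis using insert.IH [OF g' [OF True]] by (rule ex_forward) (rule impI)
    qed simp
  qed
  then obtain Q where "\<forall>a. a \<le> e \<longrightarrow> finite (Q a) \<and> card (Q a) \<le> (e - a + card B) choose card B \<and>
    (\<forall>q\<in>Q a. \<exists>b>0. hom b q) \<and>
    (\<forall>x. (\<forall>q\<in>Q a. q x = 0) \<longrightarrow> (\<forall>w\<in>vec.span B. g' a (x + w) = g' a w))"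
    by (rule choice [THEN exE])
  then have Q: "\<And>a. a \<le> e \<Longrightarrow> finite (Q a) \<and> card (Q a) \<le> (e - a + card B) choose card B \<and>
    (\<forall>q\<in>Q a. \<exists>b>0. hom b q) \<and>
    (\<forall>x. (\<forall>q\<in>Q a. q x = 0) \<longrightarrow> (\<forall>w\<in>vec.span B. g' a (x + w) = g' a w))"
    by simp
  have "card (\<Union>a\<le>e. Q a) \<le> (\<Sum>a\<le>e. card (Q a))"
    by (rule card_UN_le) simp
  also have "\<dots> \<le> (\<Sum>a\<le>e. (e - a + card B) choose card B)"
    using Q by (intro sum_mono) simp
  \<comment> \<open>Reversing the order of summation prepares the hockey-stick identity.\<close>
  also have "\<dots> = (\<Sum>a\<le>e. (a + card B) choose card B)"
    by (rule sum.reindex_bij_witness [of _ "\<lambda>a. e - a" "\<lambda>a. e - a"]) auto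
  also have "\<dots> = (\<Sum>a\<le>e. (card B + a) choose a)"
    by (simp only: choose_swap)
  also have "\<dots> = Suc (card B + e) choose e"
    by (rule sum_choose_lower)
  also have "\<dots> = (e + card (insert v B)) choose card (insert v B)"
    using insert.hyps choose_swap [of "Suc (card B)" e] by simp
  finally have card: "card (\<Union>a\<le>e. Q a) \<le> (e + card (insert v B)) choose card (insert v B)" .
  have "g (x + w) = g w" if x: "\<forall>q\<in>\<Union>a\<le>e. Q a. q x = 0" and w: "w \<in> vec.span (insert v B)" for x w
  proof -
    obtain t where t: "w - t *s v \<in> vec.span B"
      using w vec.span_breakdown_eq by blast
    define u where "u = w - t *s v"
    have "g (x + w) = g ((x + u) + t *s v)" by (simp add: u_def)
    also have "\<dots> = (\<Sum>a\<le>e. t ^ a * g' a (x + u))" by (rule g'_sum)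
    also have "\<dots> = (\<Sum>a\<le>e. t ^ a * g' a u)"
      using Q x t by (intro sum.cong) (auto simp: u_def)
    also have "\<dots> = g w" by (simp add: g'_sum [symmetric] u_def)
    finally show ?thesis .
  qed
  then show ?case
    using card Q by (intro exI [of _ "\<Union>a\<le>e. Q a"]) auto
qed

subsection \<open>Polynomial functions of bounded degree\<close>

inductive poly_deg_le :: "nat \<Rightarrow> (complex ^ 'n \<Rightarrow> complex) \<Rightarrow> bool" where
  hom: "hom b p \<Longrightarrow> b \<le> e \<Longrightarrow> poly_deg_le e p"
| add: "poly_deg_le e p \<Longrightarrow> poly_deg_le e q \<Longrightarrow> poly_deg_le e (p + q)"

lemma poly_deg_le_components:
  "poly_deg_le e p \<Longrightarrow> \<exists>c. (\<forall>b. hom b (c b)) \<and> p = (\<Sum>b\<le>e. c b)"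
proof (induction rule: poly_deg_le.induct)
  case (hom b p e)
  have "p = (\<Sum>b'\<le>e. if b' = b then p else 0)"
    using hom by simp
  then show ?case
    using hom by (intro exI [of _ "\<lambda>b'. if b' = b then p else 0"]) (auto intro: hom.intros)
next
  case (add e p q)
  then obtain c c' where "\<forall>b. hom b (c b)" "p = (\<Sum>b\<le>e. c b)"
    "\<forall>b. hom b (c' b)" "q = (\<Sum>b\<le>e. c' b)" by blast
  then show ?case
    by (intro exI [of _ "\<lambda>b. c b + c' b"]) (auto intro: hom.intros simp: sum.distrib)
qed

lemma poly_deg_le_mono: "poly_deg_le e p \<Longrightarrow> e \<le> e' \<Longrightarrow> poly_deg_le e' p"
  by (induction rule: poly_deg_le.induct) (auto intro: poly_deg_le.intros)

lemma poly_deg_le_zero: "poly_deg_le e 0"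
  by (rule poly_deg_le.hom [OF hom.zero order.refl])

lemma poly_deg_le_mult:
  assumes "poly_deg_le a p" "poly_deg_le b q"
  shows "poly_deg_le (a + b) (p * q)"
  using assms
proof (induction rule: poly_deg_le.induct)
  case (hom b' p e)
  show ?case using hom(3,1,2)
  proof (induction rule: poly_deg_le.induct)
    case (hom b'' q e')
    then show ?case by (intro poly_deg_le.hom [OF hom_mult]) auto
  qed (auto intro: poly_deg_le.intros simp: distrib_left)
qed (auto intro: poly_deg_le.intros simp: distrib_right)

lemma poly_deg_le_const: "poly_deg_le e (\<lambda>_. c)"
  by (rule poly_deg_le.hom [OF hom.const]) simp

lemma poly_deg_le_coord_diff: "poly_deg_le 1 (coord i - (\<lambda>_. c))"
proof -
  have "coord i - (\<lambda>_. c) = coord i + (\<lambda>_. - c)" by (simp add: fun_eq_iff fun_apply)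
  then show ?thesis
    using poly_deg_le.add [OF poly_deg_le.hom [OF hom_coord_self order.refl] poly_deg_le_const] by metis
qed

lemma poly_deg_le_sum: "(\<And>a. a \<in> A \<Longrightarrow> poly_deg_le e (p a)) \<Longrightarrow> poly_deg_le e (\<Sum>a\<in>A. p a)"
  by (induction A rule: infinite_finite_induct) (auto intro: poly_deg_le.intros poly_deg_le_zero)

lemma poly_deg_le_prod:
  "finite A \<Longrightarrow> (\<And>a. a \<in> A \<Longrightarrow> poly_deg_le (e a) (p a)) \<Longrightarrow>
    poly_deg_le (\<Sum>a\<in>A. e a) (\<Prod>a\<in>A. p a)"
  by (induction A rule: finite_induct)
     (auto intro: poly_deg_le_mult poly_deg_le_const simp: one_fun_def)

definition monom_fun :: "('n \<Rightarrow> nat) \<Rightarrow> complex ^ 'n \<Rightarrow> complex" where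
  "monom_fun \<alpha> = (\<Prod>i\<in>UNIV. coord i ^ \<alpha> i)"

lemma hom_monom_fun: "hom (\<Sum>i\<in>UNIV. \<alpha> i) (monom_fun (\<alpha> :: 'n::finite \<Rightarrow> nat))"
  unfolding monom_fun_def
  using hom_power [OF hom_coord_self] by (intro hom_prod) auto

lemma polynomial_fun_imp_poly_deg_le:
  assumes "polynomial_fun_degree_le d g"
  shows "poly_deg_le d g"
proof -
  obtain c where c: "\<And>x. g x = (\<Sum>\<alpha> | (\<Sum>i\<in>UNIV. \<alpha> i) \<le> d. c \<alpha> * (\<Prod>i\<in>UNIV. (x $ i) ^ \<alpha> i))"
    using assms unfolding polynomial_fun_degree_le_def by blast
  have "g = (\<Sum>\<alpha> | (\<Sum>i\<in>UNIV. \<alpha> i) \<le> d. (\<lambda>_. c \<alpha>) * monom_fun \<alpha>)"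
    by (simp add: fun_eq_iff fun_apply c sum_fun_apply monom_fun_def prod_fun_apply power_fun_apply coord_def)
  then show ?thesis
    by (auto intro!: poly_deg_le_sum intro: poly_deg_le.hom [OF hom_scale [OF hom_monom_fun]])
qed

text \<open>The equations for the homogeneous components of degree at most \<open>d\<close> are
  united; a second hockey-stick summation counts them. If \<open>g\<close> vanishes on the span of
  \<open>B\<close>, the conclusion makes it vanish on the translate of that span by
  \<open>x\<close>.\<close>

lemma invariance_conditions:
  assumes "finite B" "poly_deg_le d g"
  shows "\<exists>Q. finite Q \<and> card Q \<le> Suc (d + card B) choose Suc (card B) \<and>
    (\<forall>q\<in>Q. \<exists>b>0. hom b q) \<and>
    (\<forall>x. (\<forall>q\<in>Q. q x = 0) \<longrightarrow> (\<forall>w\<in>vec.span B. g (x + w) = g w))"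
proof -
  obtain c where c: "\<And>b. hom b (c b)" "g = (\<Sum>b\<le>d. c b)"
    using poly_deg_le_components [OF assms(2)] by blast
  obtain Q where Q: "\<And>b. finite (Q b) \<and> card (Q b) \<le> (b + card B) choose card B \<and>
    (\<forall>q\<in>Q b. \<exists>b>0. hom b q) \<and>
    (\<forall>x. (\<forall>q\<in>Q b. q x = 0) \<longrightarrow> (\<forall>w\<in>vec.span B. c b (x + w) = c b w))"
    using hom_invariance_conditions [OF assms(1) c(1)] by metis
  have "card (\<Union>b\<le>d. Q b) \<le> (\<Sum>b\<le>d. card (Q b))"
    by (rule card_UN_le) simp
  also have "\<dots> \<le> (\<Sum>b\<le>d. (card B + b) choose b)"
    using Q by (intro sum_mono) (metis choose_swap)
  also have "\<dots> = Suc (card B + d) choose d"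
    by (rule sum_choose_lower)
  also have "\<dots> = Suc (d + card B) choose Suc (card B)"
    using choose_swap [of "Suc (card B)" d] by simp
  finally have "card (\<Union>b\<le>d. Q b) \<le> Suc (d + card B) choose Suc (card B)" .
  moreover have "g (x + w) = g w" if "\<forall>q\<in>\<Union>b\<le>d. Q b. q x = 0" "w \<in> vec.span B" for x w
    using Q that by (auto simp: c(2) sum_fun_apply intro!: sum.cong)
  ultimately show ?thesis
    using Q by (intro exI [of _ "\<Union>b\<le>d. Q b"]) auto
qed

section \<open>Spaces of polynomial functions\<close>

text \<open>Dependence for an indexed family, which may repeat vectors; a repetition gives the
  relation with coefficients 1 and -1.\<close>

lemma (in vector_space) family_dependent:
  fixes A :: "'c set"
  assumes "finite A" "finite T" "card T < card A" "v ` A \<subseteq> span T"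
  shows "\<exists>c. (\<exists>a\<in>A. c a \<noteq> 0) \<and> (\<Sum>a\<in>A. scale (c a) (v a)) = 0"
proof (cases "inj_on v A")
  case True
  have "dependent (v ` A)"
    using independent_span_bound [OF assms(2) _ assms(4)] assms(3) card_image [OF True] by auto
  then obtain u where u: "\<exists>w\<in>v ` A. u w \<noteq> 0" "(\<Sum>w\<in>v ` A. scale (u w) w) = 0"
    using dependent_finite [of "v ` A"] assms(1) by auto
  then show ?thesis
    by (intro exI [of _ "u \<circ> v"]) (auto simp: sum.reindex [OF True])
next
  case False
  then obtain a b where ab: "a \<in> A" "b \<in> A" "a \<noteq> b" "v a = v b"
    by (auto simp: inj_on_def)
  define c :: "'c \<Rightarrow> 'a" where "c x = (if x = a then 1 else if x = b then - 1 else 0)" for x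
  have "(\<Sum>x\<in>A. scale (c x) (v x)) = (\<Sum>x\<in>{a, b}. scale (c x) (v x))"
    using ab assms(1) by (intro sum.mono_neutral_right) (auto simp: c_def)
  then show ?thesis
    using ab by (intro exI [of _ c]) (auto simp: c_def intro!: bexI [of _ a])
qed

text \<open>Scalars enter as constant functions, so scaling is ring multiplication and ring
  identities apply directly.\<close>

interpretation fun_space: vector_space "\<lambda>c (p :: 'a \<Rightarrow> complex). (\<lambda>_. c) * p"
  by standard (auto simp: fun_eq_iff fun_apply algebra_simps)

text \<open>Multiplication by \<open>r\<close> is linear, so spanning elements suffice. The target
  set may differ, since multiplication by a coordinate or a generator raises the degree.\<close>

lemma mult_in_span:
  assumes "p \<in> fun_space.span S" "\<And>s. s \<in> S \<Longrightarrow> r * s \<in> fun_space.span S'"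
  shows "r * p \<in> fun_space.span S'"
  using assms(1)
proof (induction rule: fun_space.span_induct_alt)
  case base
  then show ?case by (simp add: fun_space.span_zero)
next
  case (step c x y)
  have "r * ((\<lambda>_. c) * x + y) = (\<lambda>_. c) * (r * x) + r * y" by (simp add: algebra_simps)
  then show ?case
    using step assms(2) by (metis fun_space.span_add fun_space.span_scale)
qed

lemma sum_increment: "(\<Sum>j\<in>UNIV. (\<alpha>(i := Suc (\<alpha> i))) j) = Suc (\<Sum>j\<in>UNIV. \<alpha> j)"
  for \<alpha> :: "'n::finite \<Rightarrow> nat"
  by (simp add: sum.remove [of UNIV i])

lemma monom_fun_increment: "monom_fun (\<alpha>(i := Suc (\<alpha> i))) = coord i * monom_fun \<alpha>"
  by (simp add: monom_fun_def prod.remove [of UNIV i] mult.assoc)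

lemma hom_in_span_monom_fun:
  "hom e p \<Longrightarrow> p \<in> fun_space.span (monom_fun ` {\<alpha>. (\<Sum>i\<in>UNIV. \<alpha> i) = e})"
proof (induction rule: hom.induct)
  case (const c)
  have "(\<lambda>_. c) * monom_fun (\<lambda>_. 0) \<in> fun_space.span (monom_fun ` {\<alpha> :: 'a \<Rightarrow> nat. (\<Sum>i\<in>UNIV. \<alpha> i) = 0})"
    by (intro fun_space.span_scale fun_space.span_base imageI) simp
  then show ?case by (simp add: monom_fun_def)
next
  case (zero e)
  then show ?case by (rule fun_space.span_zero)
next
  case (add e p q)
  then show ?case by (intro fun_space.span_add)
next
  case (coord e p i)
  show ?case
    by (rule mult_in_span [OF coord.IH])
       (auto simp flip: monom_fun_increment simp: sum_increment
         intro!: fun_space.span_base imageI simp del: fun_upd_apply)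
qed

lemma poly_deg_le_in_span_monom_fun:
  "poly_deg_le e p \<Longrightarrow> p \<in> fun_space.span (monom_fun ` {\<alpha>. (\<Sum>i\<in>UNIV. \<alpha> i) \<le> e})"
proof (induction rule: poly_deg_le.induct)
  case (hom b p e)
  have "monom_fun ` {\<alpha> :: 'a \<Rightarrow> nat. (\<Sum>i\<in>UNIV. \<alpha> i) = b} \<subseteq> monom_fun ` {\<alpha>. (\<Sum>i\<in>UNIV. \<alpha> i) \<le> e}"
    using hom by auto
  then show ?case using hom_in_span_monom_fun [OF hom(1)] fun_space.span_mono by blast
qed (rule fun_space.span_add)

section \<open>The weak Nullstellensatz\<close>

definition is_poly :: "(complex ^ 'n \<Rightarrow> complex) \<Rightarrow> bool" where
  "is_poly p \<longleftrightarrow> (\<exists>e. poly_deg_le e p)"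

lemma is_poly_hom: "hom e p \<Longrightarrow> is_poly p"
  unfolding is_poly_def using poly_deg_le.hom by blast

lemma is_poly_const: "is_poly (\<lambda>_. c)"
  using is_poly_hom hom.const by blast

lemma is_poly_zero: "is_poly 0"
  using is_poly_hom hom.zero by blast

lemma is_poly_one: "is_poly 1"
  using is_poly_hom hom_one by blast

lemma is_poly_add: "is_poly p \<Longrightarrow> is_poly q \<Longrightarrow> is_poly (p + q)"
  unfolding is_poly_def using poly_deg_le.add poly_deg_le_mono by (metis max.cobounded1 max.cobounded2)

lemma is_poly_mult: "is_poly p \<Longrightarrow> is_poly q \<Longrightarrow> is_poly (p * q)"
  unfolding is_poly_def using poly_deg_le_mult by blast

lemma is_poly_coord_diff: "is_poly (coord i - (\<lambda>_. c))"
  unfolding is_poly_def using poly_deg_le_coord_diff by blast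

lemma is_poly_prod: "(\<And>a. a \<in> A \<Longrightarrow> is_poly (p a)) \<Longrightarrow> is_poly (\<Prod>a\<in>A. p a)"
  by (induction A rule: infinite_finite_induct)
     (auto intro: is_poly_mult is_poly_const simp: one_fun_def)

lemma is_poly_univariate: "is_poly (\<lambda>x. poly P (x $ i))"
proof (induction P)
  case 0
  then show ?case by (simp add: is_poly_const)
next
  case (pCons a P)
  have "(\<lambda>x. poly (pCons a P) (x $ i)) = (\<lambda>_. a) + coord i * (\<lambda>x. poly P (x $ i))"
    by (simp add: fun_eq_iff fun_apply coord_def)
  then show ?case
    using pCons.IH is_poly_add is_poly_mult is_poly_const is_poly_hom [OF hom_coord_self] by metis
qed

section \<open>Ideals of polynomial functions\<close>

text \<open>The ring of polynomial functions is a subset of the type of all functions, hence the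
  explicit \<open>is_poly\<close> conditions.\<close>

definition poly_ideal :: "(complex ^ 'n \<Rightarrow> complex) set \<Rightarrow> bool" where
  "poly_ideal J \<longleftrightarrow> (\<forall>p\<in>J. is_poly p) \<and> 0 \<in> J \<and> (\<forall>p\<in>J. \<forall>q\<in>J. p + q \<in> J) \<and>
     (\<forall>h p. is_poly h \<longrightarrow> p \<in> J \<longrightarrow> h * p \<in> J)"

context
  fixes J :: "(complex ^ 'n \<Rightarrow> complex) set"
  assumes J: "poly_ideal J"
begin

lemma poly_ideal_add: "p \<in> J \<Longrightarrow> q \<in> J \<Longrightarrow> p + q \<in> J"
  using J by (simp add: poly_ideal_def)

lemma poly_ideal_mult: "is_poly h \<Longrightarrow> p \<in> J \<Longrightarrow> h * p \<in> J"
  using J by (simp add: poly_ideal_def)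

lemma poly_ideal_zero: "0 \<in> J"
  using J by (simp add: poly_ideal_def)

lemma poly_ideal_minus: "p \<in> J \<Longrightarrow> - p \<in> J"
proof -
  have "- p = (\<lambda>_. - 1) * p" by (simp add: fun_eq_iff fun_apply)
  then show "p \<in> J \<Longrightarrow> - p \<in> J" using poly_ideal_mult is_poly_const by metis
qed

lemma poly_ideal_diff: "p \<in> J \<Longrightarrow> q \<in> J \<Longrightarrow> p - q \<in> J"
  using poly_ideal_add poly_ideal_minus by (metis add_uminus_conv_diff)

lemma poly_ideal_sum: "(\<And>a. a \<in> A \<Longrightarrow> p a \<in> J) \<Longrightarrow> (\<Sum>a\<in>A. p a) \<in> J"
  by (induction A rule: infinite_finite_induct) (auto intro: poly_ideal_zero poly_ideal_add)

end

text \<open>The ideal sum J + (p), used to enlarge a maximal ideal and to impose the equation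
  \<open>x $ i = 1\<close>.\<close>

lemma poly_ideal_plus_principal:
  fixes p :: "complex ^ 'n \<Rightarrow> complex"
  assumes "poly_ideal J" "is_poly p"
  shows "poly_ideal {m + p * h | m h. m \<in> J \<and> is_poly h}"
  unfolding poly_ideal_def
proof (intro conjI ballI allI impI)
  fix q assume "q \<in> {m + p * h | m h. m \<in> J \<and> is_poly h}"
  then show "is_poly q"
    using assms by (auto simp: poly_ideal_def intro: is_poly_add is_poly_mult)
next
  show "0 \<in> {m + p * h | m h. m \<in> J \<and> is_poly h}"
    using poly_ideal_zero [OF assms(1)] is_poly_zero by (auto intro!: exI [of _ 0])
next
  fix q r
  assume "q \<in> {m + p * h | m h. m \<in> J \<and> is_poly h}" "r \<in> {m + p * h | m h. m \<in> J \<and> is_poly h}"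
  then obtain m h m' h' where "q = m + p * h" "m \<in> J" "is_poly h"
    "r = m' + p * h'" "m' \<in> J" "is_poly h'" by blast
  moreover from this have "q + r = (m + m') + p * (h + h')" by (simp add: algebra_simps)
  ultimately show "q + r \<in> {m + p * h | m h. m \<in> J \<and> is_poly h}"
    using poly_ideal_add [OF assms(1)] is_poly_add by blast
next
  fix g q :: "complex ^ 'n \<Rightarrow> complex"
  assume g: "is_poly g" and "q \<in> {m + p * h | m h. m \<in> J \<and> is_poly h}"
  then obtain m h where "q = m + p * h" "m \<in> J" "is_poly h" by blast
  moreover from this have "g * q = g * m + p * (g * h)" by (simp add: algebra_simps)
  ultimately show "g * q \<in> {m + p * h | m h. m \<in> J \<and> is_poly h}"
    using g poly_ideal_mult [OF assms(1)] is_poly_mult by blast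
qed

definition maximal_poly_ideal :: "(complex ^ 'n \<Rightarrow> complex) set \<Rightarrow> bool" where
  "maximal_poly_ideal M \<longleftrightarrow> poly_ideal M \<and> 1 \<notin> M \<and>
     (\<forall>K. poly_ideal K \<longrightarrow> M \<subseteq> K \<longrightarrow> 1 \<notin> K \<longrightarrow> K = M)"

lemma maximal_poly_ideal_exists:
  assumes "poly_ideal J" "1 \<notin> J"
  shows "\<exists>M. maximal_poly_ideal M \<and> J \<subseteq> M"
proof -
  define F where "F = {K. poly_ideal K \<and> J \<subseteq> K \<and> 1 \<notin> K}"
  have "\<exists>M\<in>F. \<forall>X\<in>F. M \<subseteq> X \<longrightarrow> X = M"
  proof (rule subset_Zorn_nonempty)
    show "F \<noteq> {}" using assms by (auto simp: F_def)
  next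
    fix C assume C: "C \<noteq> {}" "subset.chain F C"
    then obtain K0 where K0: "K0 \<in> C" by blast
    have sub: "\<And>K. K \<in> C \<Longrightarrow> poly_ideal K \<and> J \<subseteq> K \<and> 1 \<notin> K"
      using C(2) by (auto simp: F_def subset_chain_def)
    have "poly_ideal (\<Union>C)"
      unfolding poly_ideal_def
    proof (intro conjI ballI allI impI)
      fix p q assume "p \<in> \<Union>C" "q \<in> \<Union>C"
      then obtain K L where KL: "K \<in> C" "L \<in> C" "p \<in> K" "q \<in> L" by blast
      then have "K \<subseteq> L \<or> L \<subseteq> K" using C(2) by (auto simp: subset_chain_def)
      then obtain N where "N \<in> C" "p \<in> N" "q \<in> N" using KL by blast
      then show "p + q \<in> \<Union>C"
        using sub [of N] poly_ideal_add [of N p q] by blast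
    next
      show "is_poly p" if "p \<in> \<Union>C" for p using that sub by (auto simp: poly_ideal_def)
      show "0 \<in> \<Union>C" using K0 sub poly_ideal_zero by blast
      show "h * p \<in> \<Union>C" if "is_poly h" "p \<in> \<Union>C" for h p
        using that sub poly_ideal_mult by blast
    qed
    then show "\<Union>C \<in> F" using sub K0 by (auto simp: F_def)
  qed
  then obtain M where M: "poly_ideal M" "J \<subseteq> M" "1 \<notin> M" "\<And>X. X \<in> F \<Longrightarrow> M \<subseteq> X \<Longrightarrow> X = M"
    by (auto simp: F_def)
  then have "maximal_poly_ideal M" by (auto simp: maximal_poly_ideal_def F_def)
  with M(2) show ?thesis by blast
qed

section \<open>Arithmetic modulo a maximal ideal\<close>

context
  fixes M :: "(complex ^ 'n \<Rightarrow> complex) set"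
  assumes M: "maximal_poly_ideal M"
begin

lemma maximal_ideal: "poly_ideal M" "1 \<notin> M"
  using M by (auto simp: maximal_poly_ideal_def)

text \<open>The quotient by \<open>M\<close> is a field: M + (p) is strictly larger than
  \<open>M\<close>, so it contains 1.\<close>

lemma maximal_ideal_inverse:
  assumes "is_poly p" "p \<notin> M"
  shows "\<exists>h. is_poly h \<and> p * h - 1 \<in> M"
proof -
  define K where "K = {m + p * h | m h. m \<in> M \<and> is_poly h}"
  have "poly_ideal K" unfolding K_def by (rule poly_ideal_plus_principal [OF maximal_ideal(1) assms(1)])
  moreover have "M \<subseteq> K"
  proof
    fix m assume "m \<in> M"
    then have "m = m + p * 0 \<and> m \<in> M \<and> is_poly 0" using is_poly_zero by simp
    then show "m \<in> K" unfolding K_def by blast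
  qed
  moreover have "p = 0 + p * 1 \<and> 0 \<in> M \<and> is_poly 1"
    using poly_ideal_zero [OF maximal_ideal(1)] is_poly_one by simp
  then have "p \<in> K" unfolding K_def by blast
  ultimately have "1 \<in> K"
    using M assms(2) by (auto simp: maximal_poly_ideal_def)
  then obtain m h where mh: "1 = m + p * h" "m \<in> M" "is_poly h" unfolding K_def by blast
  then have "p * h - 1 = - m" by (simp add: algebra_simps)
  then show ?thesis using mh poly_ideal_minus [OF maximal_ideal(1)] by metis
qed

lemma maximal_ideal_prime:
  assumes "is_poly p" "is_poly q" "p * q \<in> M" "p \<notin> M"
  shows "q \<in> M"
proof -
  obtain h where h: "is_poly h" "p * h - 1 \<in> M"
    using maximal_ideal_inverse [OF assms(1,4)] by blast
  have "h * (p * q) - q * (p * h - 1) \<in> M"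
    by (rule poly_ideal_diff [OF maximal_ideal(1) poly_ideal_mult [OF maximal_ideal(1) h(1) assms(3)]
          poly_ideal_mult [OF maximal_ideal(1) assms(2) h(2)]])
  moreover have "h * (p * q) - q * (p * h - 1) = q" by (simp add: algebra_simps)
  ultimately show ?thesis by simp
qed

lemma maximal_ideal_const:
  assumes "(\<lambda>_. c) \<in> M"
  shows "c = 0"
proof (rule ccontr)
  assume "c \<noteq> 0"
  then have "(\<lambda>_. 1 / c) * (\<lambda>_. c) = (1 :: complex ^ 'n \<Rightarrow> complex)"
    by (simp add: fun_eq_iff fun_apply)
  then show False
    using poly_ideal_mult [OF maximal_ideal(1) is_poly_const assms] maximal_ideal(2) by metis
qed

text \<open>Linear factors of \<open>P\<close> are split off by the fundamental theorem of algebra.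
  By primality either the linear factor lies in \<open>M\<close> or the cofactor does; the process
  cannot reach a constant, because \<open>M\<close> contains no nonzero constant.\<close>

lemma maximal_ideal_univariate:
  assumes "P \<noteq> 0" "(\<lambda>x. poly P (x $ i)) \<in> M"
  shows "\<exists>a. coord i - (\<lambda>_. a) \<in> M"
  using assms
proof (induction "degree P" arbitrary: P)
  case 0
  then obtain c where c: "P = [:c:]" by (metis degree_eq_zeroE)
  then show ?case using 0 maximal_ideal_const by auto
next
  case (Suc n)
  then have "\<not> constant (poly P)" by (simp add: constant_degree)
  then obtain a where "poly P a = 0" using fundamental_theorem_of_algebra by blast
  then obtain R where R: "P = [:- a, 1:] * R" by (metis dvdE poly_eq_0_iff_dvd)
  then have "R \<noteq> 0" using Suc.prems(1) by auto
  then have "degree P = degree [:- a, 1:] + degree R"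
    unfolding R by (intro degree_mult_eq) auto
  then have "degree R = n" using Suc.hyps(2) by simp
  have "(coord i - (\<lambda>_. a)) * (\<lambda>x. poly R (x $ i)) = (\<lambda>x. poly P (x $ i))"
    by (simp add: fun_eq_iff fun_apply R coord_def algebra_simps)
  then have "(coord i - (\<lambda>_. a)) * (\<lambda>x. poly R (x $ i)) \<in> M"
    using Suc.prems(2) by simp
  then show ?case
    using Suc.hyps(1) [of R] \<open>R \<noteq> 0\<close> \<open>degree R = n\<close>
      maximal_ideal_prime [OF is_poly_coord_diff is_poly_univariate] by blast
qed

text \<open>
  Otherwise each \<open>x\<^sub>i - a\<close> has an inverse modulo \<open>M\<close>. Uncountably many inverses lie in a union of
  countably many finite-dimensional spaces, so there is a linear relation between them. Clearing
  denominators turns it into a nonzero polynomial in \<open>x\<^sub>i\<close> belonging to \<open>M\<close>.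
\<close>

lemma maximal_ideal_coord: "\<exists>a. coord i - (\<lambda>_. a) \<in> M"
proof (rule ccontr)
  assume neg: "\<not> ?thesis"
  define l where "l a = coord i - (\<lambda>_ :: complex ^ 'n. a)" for a
  have l: "is_poly (l a)" for a unfolding l_def by (rule is_poly_coord_diff)
  have "\<forall>a. \<exists>h. is_poly h \<and> l a * h - 1 \<in> M"
    using neg maximal_ideal_inverse [OF l] by (auto simp: l_def)
  then obtain h where h: "\<And>a. is_poly (h a)" "\<And>a. l a * h a - 1 \<in> M"
    by metis
  then obtain t where t: "\<And>a. poly_deg_le (t a) (h a)"
    unfolding is_poly_def by metis
  \<comment> \<open>Pigeonhole: uncountably many inverses share countably many degree
    bounds.\<close>
  have "\<exists>n. infinite {a. t a = n}"
  proof (rule ccontr)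
    assume "\<not> ?thesis"
    then have "countable (\<Union>n. {a. t a = n})" by (intro countable_UN) (auto intro: countable_finite)
    moreover have "(\<Union>n. {a. t a = n}) = UNIV" by auto
    ultimately show False using uncountable_UNIV_complex by simp
  qed
  then obtain n where n: "infinite {a. t a = n}" by blast
  let ?T = "monom_fun ` {\<alpha> :: 'n \<Rightarrow> nat. (\<Sum>i\<in>UNIV. \<alpha> i) \<le> n}"
  have T: "finite ?T" by (intro finite_imageI finite_exponents_degree_le)
  obtain A where A: "A \<subseteq> {a. t a = n}" "finite A" "card A = Suc (card ?T)"
    using infinite_arbitrarily_large [OF n] by blast
  have "h ` A \<subseteq> fun_space.span ?T"
    using A(1) t poly_deg_le_in_span_monom_fun by (metis (mono_tags, lifting) image_subsetI mem_Collect_eq subsetD)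
  then obtain c a0 where c: "a0 \<in> A" "c a0 \<noteq> 0" "(\<Sum>a\<in>A. (\<lambda>_. c a) * h a) = 0"
    using fun_space.family_dependent [OF A(2) T _ \<open>h ` A \<subseteq> fun_space.span ?T\<close>] A(3) by auto
  define P where "P = (\<Sum>a\<in>A. smult (c a) (\<Prod>b\<in>A - {a}. [:- b, 1:]))"
  \<comment> \<open>At \<open>a0\<close> each summand with \<open>a \<noteq> a0\<close> contains the
    zero factor for \<open>b = a0\<close>.\<close>
  have "poly P a0 = (\<Sum>a\<in>A. if a = a0 then c a0 * (\<Prod>b\<in>A - {a0}. a0 - b) else 0)"
    unfolding P_def poly_sum
  proof (rule sum.cong)
    fix a assume "a \<in> A"
    show "poly (smult (c a) (\<Prod>b\<in>A - {a}. [:- b, 1:])) a0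
      = (if a = a0 then c a0 * (\<Prod>b\<in>A - {a0}. a0 - b) else 0)"
      using c(1) A(2) by (auto simp: poly_prod)
  qed simp
  also have "\<dots> = c a0 * (\<Prod>b\<in>A - {a0}. a0 - b)"
    using A(2) c(1) by simp
  also have "\<dots> \<noteq> 0" using A(2) c(2) by auto
  finally have "P \<noteq> 0" by auto
  have U: "(\<lambda>x. poly P (x $ i)) = (\<Sum>a\<in>A. (\<lambda>_. c a) * (\<Prod>b\<in>A - {a}. l b))"
    by (simp add: fun_eq_iff P_def poly_sum poly_prod sum_fun_apply prod_fun_apply fun_apply l_def coord_def)
  \<comment> \<open>Every summand lies in \<open>M\<close> because \<open>l a * h a - 1\<close>
    does. Expanding, the terms with \<open>h a\<close> cancel by the linear relation, leaving minus
    the polynomial \<open>P\<close> in the coordinate.\<close>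
  let ?S = "\<Sum>a\<in>A. ((\<lambda>_. c a) * (\<Prod>b\<in>A - {a}. l b)) * (l a * h a - 1)"
  have "?S = (\<Sum>a\<in>A. (\<Prod>b\<in>A. l b) * ((\<lambda>_. c a) * h a)) - (\<lambda>x. poly P (x $ i))"
    unfolding U sum_subtractf [symmetric]
  proof (rule sum.cong)
    fix a assume "a \<in> A"
    then have "(\<Prod>b\<in>A. l b) = l a * (\<Prod>b\<in>A - {a}. l b)" by (rule prod.remove [OF A(2)])
    then show "((\<lambda>_. c a) * (\<Prod>b\<in>A - {a}. l b)) * (l a * h a - 1)
      = (\<Prod>b\<in>A. l b) * ((\<lambda>_. c a) * h a) - (\<lambda>_. c a) * (\<Prod>b\<in>A - {a}. l b)"
      by (simp add: algebra_simps)
  qed simp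
  also have "(\<Sum>a\<in>A. (\<Prod>b\<in>A. l b) * ((\<lambda>_. c a) * h a)) = 0"
    unfolding sum_distrib_left [symmetric] c(3) by simp
  finally have "(\<lambda>x. poly P (x $ i)) = - ?S" by (simp only: diff_0 minus_minus)
  moreover have "?S \<in> M"
  proof (rule poly_ideal_sum [OF maximal_ideal(1)])
    fix a
    have "is_poly ((\<lambda>_. c a) * (\<Prod>b\<in>A - {a}. l b))"
      by (rule is_poly_mult [OF is_poly_const is_poly_prod [OF l]])
    then show "((\<lambda>_. c a) * (\<Prod>b\<in>A - {a}. l b)) * (l a * h a - 1) \<in> M"
      by (rule poly_ideal_mult [OF maximal_ideal(1) _ h(2)])
  qed
  then have "- ?S \<in> M" by (rule poly_ideal_minus [OF maximal_ideal(1)])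
  ultimately have "(\<lambda>x. poly P (x $ i)) \<in> M" by (simp only:)
  then show False
    using maximal_ideal_univariate [OF \<open>P \<noteq> 0\<close>] neg by blast
qed

text \<open>The coordinates are congruent to constants modulo \<open>M\<close>, and congruence
  respects sums and products, so every polynomial is congruent to its value at
  \<open>z\<close>.\<close>

lemma maximal_ideal_evaluation:
  assumes "\<And>i. coord i - (\<lambda>_. z $ i) \<in> M" "is_poly p"
  shows "p - (\<lambda>_. p z) \<in> M"
proof -
  note I = maximal_ideal(1)
  have hom: "p - (\<lambda>_. p z) \<in> M" if "hom e p" for e p
    using that
  proof (induction rule: hom.induct)
    case (const c)
    have "(\<lambda>_. c) - (\<lambda>_. c) = (0 :: complex ^ 'n \<Rightarrow> complex)" by simp
    then show ?case using poly_ideal_zero [OF I] by metis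
  next
    case (zero e)
    have "0 - (\<lambda>_. 0 z) = (0 :: complex ^ 'n \<Rightarrow> complex)" by (simp add: fun_eq_iff fun_apply)
    then show ?case using poly_ideal_zero [OF I] by metis
  next
    case (add e p q)
    have "p + q - (\<lambda>_. (p + q) z) = (p - (\<lambda>_. p z)) + (q - (\<lambda>_. q z))"
      by (simp add: fun_eq_iff fun_apply)
    then show ?case using add.IH poly_ideal_add [OF I] by metis
  next
    case (coord e p i)
    have "coord i * p - (\<lambda>_. (coord i * p) z)
      = coord i * (p - (\<lambda>_. p z)) + (\<lambda>_. p z) * (coord i - (\<lambda>_. z $ i))"
      by (simp add: fun_eq_iff fun_apply coord_def algebra_simps)
    then show ?case
      using poly_ideal_add [OF I poly_ideal_mult [OF I is_poly_hom [OF hom_coord_self] coord.IH]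
          poly_ideal_mult [OF I is_poly_const assms(1)]] by metis
  qed
  obtain e where "poly_deg_le e p" using assms(2) is_poly_def by blast
  then show ?thesis
  proof (induction rule: poly_deg_le.induct)
    case (hom b p e)
    then show ?case using \<open>\<And>p e. hom e p \<Longrightarrow> p - (\<lambda>_. p z) \<in> M\<close> by blast
  next
    case (add e p q)
    have "p + q - (\<lambda>_. (p + q) z) = (p - (\<lambda>_. p z)) + (q - (\<lambda>_. q z))"
      by (simp add: fun_eq_iff fun_apply)
    then show ?case using add.IH poly_ideal_add [OF I] by metis
  qed
qed

end

text \<open>In a maximal ideal containing \<open>J\<close>, each coordinate is congruent to a
  constant; these constants form \<open>z\<close>. For \<open>p\<close> in \<open>J\<close> the
  constant \<open>p z\<close> then lies in the maximal ideal, hence is 0.\<close>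

theorem weak_nullstellensatz:
  assumes "poly_ideal J" "1 \<notin> J"
  shows "\<exists>z. \<forall>p\<in>J. p z = 0"
proof -
  obtain M where M: "maximal_poly_ideal M" "J \<subseteq> M"
    using maximal_poly_ideal_exists [OF assms] by blast
  obtain a where a: "\<And>i. coord i - (\<lambda>_. a i) \<in> M"
    using maximal_ideal_coord [OF M(1)] by metis
  define z where "z = (\<chi> i. a i)"
  have "p z = 0" if "p \<in> J" for p
  proof -
    have p: "p \<in> M" "is_poly p" using that M assms(1) by (auto simp: poly_ideal_def)
    have "p - (\<lambda>_. p z) \<in> M"
      using a by (intro maximal_ideal_evaluation [OF M(1) _ p(2)]) (simp add: z_def)
    then have "p - (p - (\<lambda>_. p z)) \<in> M"
      by (rule poly_ideal_diff [OF maximal_ideal(1) [OF M(1)] p(1)])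
    moreover have "p - (p - (\<lambda>_. p z)) = (\<lambda>_. p z)" by (simp add: fun_eq_iff fun_apply)
    ultimately show ?thesis using maximal_ideal_const [OF M(1)] by simp
  qed
  then show ?thesis by blast
qed

section \<open>Common zeros of homogeneous polynomial functions\<close>

text \<open>Coefficients are indexed by the generators themselves. For infinite \<open>Q\<close> the
  sum is 0 by convention, and the result is the zero ideal.\<close>

definition generated_ideal :: "(complex ^ 'n \<Rightarrow> complex) set \<Rightarrow> (complex ^ 'n \<Rightarrow> complex) set" where
  "generated_ideal Q = {\<Sum>q\<in>Q. g q * q | g. \<forall>q. is_poly (g q)}"

lemma generated_idealI: "(\<And>q. is_poly (g q)) \<Longrightarrow> (\<Sum>q\<in>Q. g q * q) \<in> generated_ideal Q"
  unfolding generated_ideal_def by blast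

lemma poly_ideal_generated:
  fixes Q :: "(complex ^ 'n \<Rightarrow> complex) set"
  assumes "\<And>q. q \<in> Q \<Longrightarrow> is_poly q"
  shows "poly_ideal (generated_ideal Q)"
  unfolding poly_ideal_def
proof (intro conjI ballI allI impI)
  fix p assume "p \<in> generated_ideal Q"
  then obtain g where g: "p = (\<Sum>q\<in>Q. g q * q)" "\<And>q. is_poly (g q)"
    unfolding generated_ideal_def by blast
  have "is_poly (\<Sum>q\<in>A. g q * q)" if "A \<subseteq> Q" for A
    using that by (induction A rule: infinite_finite_induct)
      (auto intro: is_poly_zero is_poly_add is_poly_mult g(2) assms)
  then show "is_poly p" using g by blast
next
  show "0 \<in> generated_ideal Q"
    unfolding generated_ideal_def
    by (rule CollectI, rule exI [of _ "\<lambda>_. 0"]) (simp add: is_poly_zero)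
next
  fix p r assume "p \<in> generated_ideal Q" "r \<in> generated_ideal Q"
  then obtain g h where "p = (\<Sum>q\<in>Q. g q * q)" "\<And>q. is_poly (g q)"
    "r = (\<Sum>q\<in>Q. h q * q)" "\<And>q. is_poly (h q)"
    unfolding generated_ideal_def by blast
  moreover from this have "p + r = (\<Sum>q\<in>Q. (g q + h q) * q)"
    by (simp add: distrib_right sum.distrib)
  moreover have "(\<Sum>q\<in>Q. (g q + h q) * q) \<in> generated_ideal Q"
    by (rule generated_idealI) (intro is_poly_add calculation)
  ultimately show "p + r \<in> generated_ideal Q" by (simp only:)
next
  fix h p :: "complex ^ 'n \<Rightarrow> complex"
  assume h: "is_poly h" and "p \<in> generated_ideal Q"
  then obtain g where g: "p = (\<Sum>q\<in>Q. g q * q)" "\<And>q. is_poly (g q)"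
    unfolding generated_ideal_def by blast
  then have "h * p = (\<Sum>q\<in>Q. (h * g q) * q)"
    by (simp add: sum_distrib_left mult.assoc)
  moreover have "(\<Sum>q\<in>Q. (h * g q) * q) \<in> generated_ideal Q"
    by (rule generated_idealI) (intro is_poly_mult h g(2))
  ultimately show "h * p \<in> generated_ideal Q" by (simp only:)
qed

lemma generator_in_generated_ideal:
  fixes q :: "complex ^ 'n \<Rightarrow> complex"
  assumes "finite Q" "q \<in> Q"
  shows "q \<in> generated_ideal Q"
proof -
  define g :: "(complex ^ 'n \<Rightarrow> complex) \<Rightarrow> complex ^ 'n \<Rightarrow> complex"
    where "g r = (if r = q then 1 else 0)" for r
  have "(\<Sum>r\<in>Q. g r * r) = (\<Sum>r\<in>Q. if r = q then q else 0)"
    by (rule sum.cong) (auto simp: g_def)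
  then have "q = (\<Sum>r\<in>Q. g r * r)" using assms by simp
  moreover have "\<forall>r. is_poly (g r)" by (auto simp: g_def is_poly_zero is_poly_one)
  ultimately show ?thesis unfolding generated_ideal_def by blast
qed

text \<open>
  Since the generators have no common zero on the affine hyperplane \<open>x\<^sub>i = 1\<close>, they generate the unit
  ideal there; homogenising with respect to \<open>x\<^sub>i\<close> gives a power of \<open>x\<^sub>i\<close>.
\<close>

lemma coord_power_in_homogeneous_ideal:
  fixes Q :: "(complex ^ 'n \<Rightarrow> complex) set"
  assumes fin: "finite Q" and Q: "\<And>q. q \<in> Q \<Longrightarrow> hom (dg q) q"
    and triv: "\<And>x. (\<forall>q\<in>Q. q x = 0) \<Longrightarrow> x = 0"
  shows "\<exists>N g. (\<forall>q\<in>Q. dg q \<le> N \<and> hom (N - dg q) (g q)) \<and> coord i ^ N = (\<Sum>q\<in>Q. g q * q)"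
proof -
  let ?l = "coord i - (\<lambda>_ :: complex ^ 'n. 1)"
  let ?I = "generated_ideal Q"
  let ?J = "{m + ?l * h | m h. m \<in> ?I \<and> is_poly h}"
  have I: "poly_ideal ?I" using Q is_poly_hom by (intro poly_ideal_generated) blast
  have J: "poly_ideal ?J" by (intro poly_ideal_plus_principal I is_poly_coord_diff)
  have "1 \<in> ?J"
  \<comment> \<open>A common zero of \<open>?J\<close> would be 0 by \<open>triv\<close>, yet have
    \<open>i\<close>-th coordinate 1.\<close>
  proof (rule ccontr)
    assume "1 \<notin> ?J"
    then obtain z where z: "\<And>p. p \<in> ?J \<Longrightarrow> p z = 0"
      using weak_nullstellensatz [OF J] by blast
    have "q z = 0" if "q \<in> Q" for q
    proof (rule z)
      have "q = q + ?l * 0 \<and> q \<in> ?I \<and> is_poly 0"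
        using generator_in_generated_ideal [OF fin that] is_poly_zero by simp
      then show "q \<in> ?J" by blast
    qed
    then have "z = 0" using triv by blast
    moreover have "?l z = 0"
    proof (rule z)
      have "?l = 0 + ?l * 1 \<and> 0 \<in> ?I \<and> is_poly 1"
        using poly_ideal_zero [OF I] is_poly_one by simp
      then show "?l \<in> ?J" by blast
    qed
    ultimately show False by (simp add: fun_apply coord_def)
  qed
  then obtain g h where gh: "1 = (\<Sum>q\<in>Q. g q * q) + ?l * h" "\<And>q. is_poly (g q)"
    unfolding generated_ideal_def by blast
  obtain E' where E': "\<And>q. poly_deg_le (E' q) (g q)"
    using gh(2) unfolding is_poly_def by metis
  define E where "E = (\<Sum>q\<in>Q. E' q)"
  have "poly_deg_le E (g q)" if "q \<in> Q" for q
    using that fin member_le_sum [of q Q E'] by (intro poly_deg_le_mono [OF E']) (simp add: E_def)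
  then have "\<forall>q. \<exists>c. q \<in> Q \<longrightarrow> (\<forall>b. hom b (c b)) \<and> g q = (\<Sum>b\<le>E. c b)"
    using poly_deg_le_components by blast
  then obtain c where c: "\<And>q b. q \<in> Q \<Longrightarrow> hom b (c q b)" "\<And>q. q \<in> Q \<Longrightarrow> g q = (\<Sum>b\<le>E. c q b)"
    by metis
  \<comment> \<open>The successor makes every exponent \<open>N - dg q - b\<close> below positive,
    so that both sides of the identity vanish where \<open>x $ i = 0\<close>.\<close>
  define N where "N = Suc (E + (\<Sum>q\<in>Q. dg q))"
  have N: "dg q + b < N" if "q \<in> Q" "b \<le> E" for q b
    using that fin member_le_sum [of q Q dg] by (simp add: N_def)
  \<comment> \<open>Homogenisation: each component of the cofactor is lifted to degree
    \<open>N - dg q\<close> by a power of the coordinate.\<close>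
  define g' where "g' q = (\<Sum>b\<le>E. coord i ^ (N - dg q - b) * c q b)" for q
  have "hom (N - dg q) (g' q)" if "q \<in> Q" for q
    unfolding g'_def
  proof (rule hom_sum)
    fix b assume "b \<in> {..E}"
    then have "N - dg q = 1 * (N - dg q - b) + b" using N [OF that, of b] by simp
    then show "hom (N - dg q) (coord i ^ (N - dg q - b) * c q b)"
      using hom_mult [OF hom_power [OF hom_coord_self] c(1) [OF that]] by metis
  qed
  moreover have "dg q \<le> N" if "q \<in> Q" for q using N [OF that, of 0] by simp
  moreover have "(coord i ^ N) x = (\<Sum>q\<in>Q. g' q * q) x" for x
  proof (cases "x $ i = 0")
    case True
    have "(g' q) x = 0" if "q \<in> Q" for q
      unfolding g'_def sum_fun_apply
    proof (rule sum.neutral, rule ballI)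
      fix b assume "b \<in> {..E}"
      then show "(coord i ^ (N - dg q - b) * c q b) x = 0"
        using N [OF that, of b] True by (simp add: fun_apply power_fun_apply coord_def)
    qed
    moreover have "N > 0" by (simp add: N_def)
    ultimately show ?thesis
      using True by (simp add: sum_fun_apply fun_apply power_fun_apply coord_def)
  next
    case False
    define u where "u = x $ i"
    \<comment> \<open>The point \<open>y\<close> lies on the hyperplane where the unit identity
      holds; multiplying that identity by \<open>u ^ N\<close> transports it to
      \<open>x\<close>.\<close>
    define y where "y = (1 / u) *s x"
    have u: "u \<noteq> 0" using False by (simp add: u_def)
    have x: "x = u *s y" using u by (simp add: y_def vec_eq_iff)
    have "y $ i = 1" using u by (simp add: y_def u_def)
    then have 1: "1 = (\<Sum>q\<in>Q. g q y * q y)"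
      using fun_cong [OF gh(1), of y] by (simp add: fun_apply sum_fun_apply coord_def)
    have "(g' q * q) x = u ^ N * (g q y * q y)" if q: "q \<in> Q" for q
    proof -
      have "g' q x = (\<Sum>b\<le>E. u ^ (N - dg q) * c q b y)"
        unfolding g'_def sum_fun_apply
      proof (rule sum.cong)
        fix b assume "b \<in> {..E}"
        then have "N - dg q = (N - dg q - b) + b" using N [OF q, of b] by simp
        then have "u ^ (N - dg q) = u ^ (N - dg q - b) * u ^ b" by (metis power_add)
        moreover have "c q b x = u ^ b * c q b y"
          unfolding x by (rule hom_scaled_arg [OF c(1) [OF q]])
        ultimately show "(coord i ^ (N - dg q - b) * c q b) x = u ^ (N - dg q) * c q b y"
          by (simp add: fun_apply power_fun_apply coord_def u_def [symmetric])
      qed simp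
      also have "\<dots> = u ^ (N - dg q) * g q y"
        by (simp add: c(2) [OF q] sum_fun_apply sum_distrib_left)
      finally have "(g' q * q) x = (u ^ (N - dg q) * u ^ dg q) * (g q y * q y)"
        using hom_scaled_arg [OF Q [OF q], of u y] x by (simp add: fun_apply mult_ac)
      also have "u ^ (N - dg q) * u ^ dg q = u ^ N"
        using N [OF q, of 0] by (simp flip: power_add)
      finally show ?thesis .
    qed
    then have "(\<Sum>q\<in>Q. g' q * q) x = u ^ N * (\<Sum>q\<in>Q. g q y * q y)"
      by (simp add: sum_fun_apply sum_distrib_left)
    then show ?thesis using 1 by (simp add: power_fun_apply coord_def u_def)
  qed
  ultimately show ?thesis by (intro exI [of _ N] exI [of _ g']) (auto simp: fun_eq_iff)
qed

text \<open>
  If some power of each coordinate lies in the ideal generated by \<open>Q\<close>, then the polynomial ring is a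
  finitely generated module over the subring generated by \<open>Q\<close>. The functions below span it in degree
  at most \<open>e\<close>.
\<close>

definition module_span :: "('n \<Rightarrow> nat) \<Rightarrow> (complex ^ 'n \<Rightarrow> complex) set \<Rightarrow> nat \<Rightarrow> (complex ^ 'n \<Rightarrow> complex) set" where
  "module_span N Q e = (\<lambda>(\<alpha>, \<beta>). monom_fun \<alpha> * (\<Prod>q\<in>Q. q ^ \<beta> q)) `
     (PiE UNIV (\<lambda>i. {..<N i}) \<times> (Q \<rightarrow>\<^sub>E {..e}))"

lemma finite_module_span: "finite Q \<Longrightarrow> finite (module_span N Q e)"
  unfolding module_span_def by (intro finite_imageI finite_cartesian_product finite_PiE) auto

lemma card_module_span:
  assumes "finite Q"
  shows "card (module_span N Q e) \<le> (\<Prod>i\<in>UNIV. N i) * Suc e ^ card Q"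
proof -
  have "card (module_span N Q e) \<le> card (PiE UNIV (\<lambda>i. {..<N i}) \<times> (Q \<rightarrow>\<^sub>E {..e}))"
    unfolding module_span_def
    using assms by (intro card_image_le finite_cartesian_product finite_PiE) auto
  then show ?thesis
    using assms by (simp add: card_cartesian_product card_PiE)
qed

lemma module_span_mono: "e \<le> e' \<Longrightarrow> module_span N Q e \<subseteq> module_span N Q e'"
  unfolding module_span_def by (intro image_mono Sigma_mono PiE_mono) auto

lemma mult_generator_module_span:
  assumes "finite Q" "q \<in> Q" "s \<in> module_span N Q e"
  shows "q * s \<in> module_span N Q (Suc e)"
proof -
  obtain \<alpha> \<beta> where s: "s = monom_fun \<alpha> * (\<Prod>q\<in>Q. q ^ \<beta> q)"
    and \<alpha>: "\<alpha> \<in> PiE UNIV (\<lambda>i. {..<N i})" and \<beta>: "\<beta> \<in> Q \<rightarrow>\<^sub>E {..e}"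
    using assms(3) unfolding module_span_def by auto
  define \<beta>' where "\<beta>' = \<beta>(q := Suc (\<beta> q))"
  have "(\<Prod>r\<in>Q. r ^ \<beta>' r) = q * (\<Prod>r\<in>Q. r ^ \<beta> r)"
    using assms(1,2) by (simp add: prod.remove [of Q q] \<beta>'_def mult.assoc)
  then have "q * s = monom_fun \<alpha> * (\<Prod>r\<in>Q. r ^ \<beta>' r)"
    by (simp add: s mult_ac)
  moreover have "\<beta>' \<in> Q \<rightarrow>\<^sub>E {..Suc e}"
    using \<beta> assms(2) by (auto simp: \<beta>'_def PiE_iff extensional_def le_SucI)
  ultimately show ?thesis
    unfolding module_span_def using \<alpha> by (auto intro!: image_eqI [where x = "(\<alpha>, \<beta>')"])
qed

text \<open>Strong induction on the degree. In a monomial with an exponent at least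
  \<open>N i\<close>, the power \<open>coord i ^ N i\<close> is replaced by a combination of
  generators, whose cofactors have lower degree. Multiplying back by \<open>q\<close> raises one
  exponent by 1, which fits the bound \<open>e\<close> because \<open>dg q > 0\<close>.\<close>

lemma hom_in_module_span:
  fixes Q :: "(complex ^ 'n \<Rightarrow> complex) set"
  assumes fin: "finite Q" and Q: "\<And>q. q \<in> Q \<Longrightarrow> dg q > 0"
    and g: "\<And>i q. q \<in> Q \<Longrightarrow> dg q \<le> N i \<and> hom (N i - dg q) (g i q)"
    and N: "\<And>i. coord i ^ N i = (\<Sum>q\<in>Q. g i q * q)"
  shows "hom e p \<Longrightarrow> p \<in> fun_space.span (module_span N Q e)"
proof (induction e arbitrary: p rule: less_induct)
  case (less e)
  have "monom_fun \<alpha> \<in> fun_space.span (module_span N Q e)" if \<alpha>: "(\<Sum>i\<in>UNIV. \<alpha> i) = e" for \<alpha>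
  proof (cases "\<forall>i. \<alpha> i < N i")
    case True
    let ?\<beta> = "\<lambda>q\<in>Q. 0"
    have "monom_fun \<alpha> = monom_fun \<alpha> * (\<Prod>q\<in>Q. q ^ ?\<beta> q)" by simp
    then have "monom_fun \<alpha> \<in> module_span N Q e"
      unfolding module_span_def using True
      by (intro image_eqI [where x = "(\<alpha>, ?\<beta>)"]) auto
    then show ?thesis by (rule fun_space.span_base)
  next
    case False
    then obtain i where i: "N i \<le> \<alpha> i" by (auto simp: not_less)
    define \<alpha>' where "\<alpha>' = \<alpha>(i := \<alpha> i - N i)"
    have "monom_fun \<alpha> = coord i ^ N i * monom_fun \<alpha>'"
      using i by (simp add: monom_fun_def prod.remove [of UNIV i] \<alpha>'_def mult.assoc [symmetric] flip: power_add)
    also have "\<dots> = (\<Sum>q\<in>Q. q * (g i q * monom_fun \<alpha>'))"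
      unfolding N sum_distrib_right by (rule sum.cong) (simp_all add: mult_ac)
    finally have eq: "monom_fun \<alpha> = (\<Sum>q\<in>Q. q * (g i q * monom_fun \<alpha>'))" .
    have \<alpha>': "e = N i + (\<Sum>j\<in>UNIV. \<alpha>' j)"
      using i by (simp add: \<alpha> [symmetric] \<alpha>'_def sum.remove [of UNIV i])
    show ?thesis
      unfolding eq
    proof (rule fun_space.span_sum)
      fix q assume q: "q \<in> Q"
      have "N i - dg q + (\<Sum>j\<in>UNIV. \<alpha>' j) = e - dg q" using g [OF q, of i] \<alpha>' by simp
      then have "hom (e - dg q) (g i q * monom_fun \<alpha>')"
        using hom_mult [OF conjunct2 [OF g [OF q, of i]] hom_monom_fun] by metis
      moreover have lt: "e - dg q < e" using Q [OF q] g [OF q, of i] \<alpha>' by linarith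
      ultimately have "g i q * monom_fun \<alpha>' \<in> fun_space.span (module_span N Q (e - dg q))"
        by (intro less.IH)
      then show "q * (g i q * monom_fun \<alpha>') \<in> fun_space.span (module_span N Q e)"
      proof (rule mult_in_span)
        fix s assume "s \<in> module_span N Q (e - dg q)"
        then have "q * s \<in> module_span N Q (Suc (e - dg q))"
          by (rule mult_generator_module_span [OF fin q])
        then show "q * s \<in> fun_space.span (module_span N Q e)"
          using module_span_mono [of "Suc (e - dg q)" e N Q] lt by (auto intro: fun_space.span_base)
      qed
    qed
  qed
  then have "monom_fun ` {\<alpha>. (\<Sum>i\<in>UNIV. \<alpha> i) = e} \<subseteq> fun_space.span (module_span N Q e)" by auto
  then show ?case
    using hom_in_span_monom_fun [OF less.prems] fun_space.span_minimal fun_space.subspace_span by blast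
qed

section \<open>Interpolation on a grid and comparison of dimensions\<close>

text \<open>Products over the coordinates of one-variable Lagrange basis polynomials with nodes 0,
  ..., \<open>s\<close>. On grid points they act as indicator functions, hence are linearly
  independent.\<close>

definition lagrange :: "nat \<Rightarrow> ('n \<Rightarrow> nat) \<Rightarrow> complex ^ 'n \<Rightarrow> complex" where
  "lagrange s \<pi> = (\<Prod>i\<in>UNIV. \<Prod>b\<in>{..s} - {\<pi> i}.
     (\<lambda>_. 1 / (of_nat (\<pi> i) - of_nat b)) * (coord i - (\<lambda>_. of_nat b)))"

lemma poly_deg_le_lagrange:
  fixes \<pi> :: "'n::finite \<Rightarrow> nat"
  assumes "\<And>i. \<pi> i \<le> s"
  shows "poly_deg_le (CARD('n) * s) (lagrange s \<pi>)"
proof -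
  have "poly_deg_le 1 ((\<lambda>_. c) * (coord i - (\<lambda>_ :: complex ^ 'n. b)))" for c b and i :: 'n
    using poly_deg_le_mult [OF poly_deg_le_const [of 0] poly_deg_le_coord_diff] by simp
  then have "poly_deg_le (\<Sum>i\<in>(UNIV :: 'n set). \<Sum>b\<in>{..s} - {\<pi> i}. 1) (lagrange s \<pi>)"
    unfolding lagrange_def by (intro poly_deg_le_prod) auto
  moreover have "(\<Sum>i\<in>(UNIV :: 'n set). \<Sum>b\<in>{..s} - {\<pi> i}. (1 :: nat)) = CARD('n) * s"
    using assms by simp
  ultimately show ?thesis by metis
qed

lemma lagrange_apply:
  fixes \<pi> \<omega> :: "'n::finite \<Rightarrow> nat"
  assumes "\<And>i. \<omega> i \<le> s"
  shows "lagrange s \<pi> (\<chi> i. of_nat (\<omega> i)) = (if \<pi> = \<omega> then 1 else 0)"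
proof (cases "\<pi> = \<omega>")
  case True
  then show ?thesis
    by (auto simp: lagrange_def prod_fun_apply fun_apply coord_def intro!: prod.neutral)
next
  case False
  then obtain i where "\<pi> i \<noteq> \<omega> i" by blast
  then have "(\<Prod>b\<in>{..s} - {\<pi> i}.
     1 / (of_nat (\<pi> i) - of_nat b) * (of_nat (\<omega> i) - of_nat b)) = (0 :: complex)"
    using assms by (intro prod_zero) auto
  then show ?thesis
    using False by (auto simp: lagrange_def prod_fun_apply fun_apply coord_def intro!: prod_zero bexI [of _ i])
qed

theorem homogeneous_common_zero:
  fixes Q :: "(complex ^ 'n \<Rightarrow> complex) set"
  assumes fin: "finite Q" and card: "card Q < CARD('n)" and Q: "\<And>q. q \<in> Q \<Longrightarrow> \<exists>b>0. hom b q"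
  shows "\<exists>x. x \<noteq> 0 \<and> (\<forall>q\<in>Q. q x = 0)"
proof (rule ccontr)
  assume "\<not> ?thesis"
  then have triv: "\<And>x. (\<forall>q\<in>Q. q x = 0) \<Longrightarrow> x = 0" by blast
  obtain dg where dg: "\<And>q. q \<in> Q \<Longrightarrow> dg q > 0" "\<And>q. q \<in> Q \<Longrightarrow> hom (dg q) q"
    using Q by metis
  have "\<forall>i. \<exists>N g. (\<forall>q\<in>Q. dg q \<le> N \<and> hom (N - dg q) (g q)) \<and> coord i ^ N = (\<Sum>q\<in>Q. g q * q)"
    by (intro allI coord_power_in_homogeneous_ideal [OF fin dg(2) triv])
  then obtain N where "\<forall>i. \<exists>g. (\<forall>q\<in>Q. dg q \<le> N i \<and> hom (N i - dg q) (g q)) \<and>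
      coord i ^ N i = (\<Sum>q\<in>Q. g q * q)"
    by (rule choice [THEN exE])
  then obtain g where "\<forall>i. (\<forall>q\<in>Q. dg q \<le> N i \<and> hom (N i - dg q) (g i q)) \<and>
      coord i ^ N i = (\<Sum>q\<in>Q. g i q * q)"
    by (rule choice [THEN exE])
  then have g: "\<And>i q. q \<in> Q \<Longrightarrow> dg q \<le> N i \<and> hom (N i - dg q) (g i q)"
    and N: "\<And>i. coord i ^ N i = (\<Sum>q\<in>Q. g i q * q)"
    by simp_all
  have span: "p \<in> fun_space.span (module_span N Q t)" if "poly_deg_le t p" for p t
    using that
  proof (induction rule: poly_deg_le.induct)
    case (hom b p e)
    then show ?case
      using hom_in_module_span [OF fin dg(1) g N hom(1)] fun_space.span_mono [OF module_span_mono [OF hom(2)]]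
      by blast
  qed (rule fun_space.span_add)
  let ?n = "CARD('n)" and ?r = "card Q" and ?C = "\<Prod>i\<in>UNIV. N i"
  \<comment> \<open>Otherwise the interpolation functions outnumber a set whose span contains them;
    evaluating the resulting relation at a grid point isolates one coefficient.\<close>
  have le: "Suc s ^ ?n \<le> ?C * Suc (?n * s) ^ ?r" for s
  proof (rule ccontr)
    let ?P = "PiE (UNIV :: 'n set) (\<lambda>_. {..s})"
    assume "\<not> ?thesis"
    moreover have "card ?P = Suc s ^ ?n" by (simp add: card_PiE)
    ultimately have lt: "card (module_span N Q (?n * s)) < card ?P"
      using card_module_span [OF fin, of N "?n * s"] by simp
    have sub: "lagrange s ` ?P \<subseteq> fun_space.span (module_span N Q (?n * s))"
    proof
      fix p assume "p \<in> lagrange s ` ?P"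
      then obtain \<pi> where "p = lagrange s \<pi>" "\<pi> \<in> ?P" by (rule imageE)
      then show "p \<in> fun_space.span (module_span N Q (?n * s))"
        by (auto intro!: span poly_deg_le_lagrange)
    qed
    have "finite ?P" by (intro finite_PiE) auto
    obtain c \<omega> where c: "\<omega> \<in> ?P" "c \<omega> \<noteq> 0" "(\<Sum>\<pi>\<in>?P. (\<lambda>_. c \<pi>) * lagrange s \<pi>) = 0"
      using fun_space.family_dependent [OF \<open>finite ?P\<close> finite_module_span [OF fin] lt sub] by blast
    have \<omega>: "\<And>i. \<omega> i \<le> s" using c(1) by auto
    have "0 = (\<Sum>\<pi>\<in>?P. (\<lambda>_. c \<pi>) * lagrange s \<pi>) (\<chi> i. of_nat (\<omega> i))"
      by (simp add: c(3) fun_apply)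
    also have "\<dots> = (\<Sum>\<pi>\<in>?P. if \<pi> = \<omega> then c \<omega> else 0)"
      unfolding sum_fun_apply by (rule sum.cong) (auto simp: fun_apply lagrange_apply [OF \<omega>])
    also have "\<dots> = c \<omega>" using c(1) \<open>finite ?P\<close> by simp
    finally show False using c(2) by simp
  qed
  \<comment> \<open>Chosen so that \<open>?C * (?n * Suc s) ^ ?r\<close> equals
    \<open>Suc s ^ ?r * s\<close>, which is less than \<open>Suc s ^ Suc ?r\<close> and so less than
    \<open>Suc s ^ ?n\<close>.\<close>
  define s where "s = ?C * ?n ^ ?r"
  have n: "?n > 0" by simp
  have "Suc s ^ ?r * Suc s \<le> Suc s ^ ?r * Suc s ^ (?n - ?r)"
    using card by (intro mult_left_mono) (auto intro: self_le_power)
  also have "\<dots> = Suc s ^ ?n" using card by (simp flip: power_add)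
  also have "\<dots> \<le> ?C * Suc (?n * s) ^ ?r" by (rule le)
  also have "\<dots> \<le> ?C * (?n * Suc s) ^ ?r"
    using n by (intro mult_left_mono power_mono) auto
  also have "\<dots> = Suc s ^ ?r * s" by (simp only: s_def power_mult_distrib mult_ac)
  finally show False by simp
qed

section \<open>Linear subspaces in the zero set\<close>

text \<open>Conjugation falls on the fixed vector, so orthogonality to \<open>v\<close> is a
  complex-linear equation in \<open>x\<close>.\<close>

lemma hom_hermitian_form: "hom 1 (\<lambda>x. \<Sum>i\<in>UNIV. cnj (v $ i) * x $ i)"
proof -
  have "(\<lambda>x. \<Sum>i\<in>UNIV. cnj (v $ i) * x $ i) = (\<Sum>i\<in>UNIV. (\<lambda>_. cnj (v $ i)) * coord i)"
    by (simp add: fun_eq_iff sum_fun_apply fun_apply coord_def)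
  moreover have "hom 1 (\<Sum>i\<in>UNIV. (\<lambda>_. cnj (v $ i)) * coord i)"
    by (intro hom_sum hom_scale hom_coord_self)
  ultimately show ?thesis by (simp only:)
qed

text \<open>A vector of the span would be orthogonal to itself. Conjugation is essential: without
  it, nonzero isotropic vectors exist.\<close>

lemma orthogonal_notin_span:
  fixes x :: "complex ^ 'n"
  assumes "x \<noteq> 0" and orth: "\<And>v. v \<in> B \<Longrightarrow> (\<Sum>i\<in>UNIV. cnj (v $ i) * x $ i) = 0"
  shows "x \<notin> vec.span B"
proof
  assume "x \<in> vec.span B"
  have "(\<Sum>i\<in>UNIV. cnj (w $ i) * x $ i) = 0" if "w \<in> vec.span B" for w
    using that
  proof (induction rule: vec.span_induct_alt)
    case (step c v w)
    have "(\<Sum>i\<in>UNIV. cnj ((c *s v + w) $ i) * x $ i)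
      = cnj c * (\<Sum>i\<in>UNIV. cnj (v $ i) * x $ i) + (\<Sum>i\<in>UNIV. cnj (w $ i) * x $ i)"
      by (simp add: sum_distrib_left sum.distrib algebra_simps)
    then show ?case using step orth by simp
  qed simp
  then have "(\<Sum>i\<in>UNIV. cnj (x $ i) * x $ i) = 0"
    using \<open>x \<in> vec.span B\<close> by blast
  moreover have "(\<Sum>i\<in>UNIV. cnj (x $ i) * x $ i) = of_real (\<Sum>i\<in>UNIV. (cmod (x $ i))\<^sup>2)"
    unfolding of_real_sum by (rule sum.cong) (simp_all only: complex_norm_square mult.commute)
  ultimately have "(\<Sum>i\<in>UNIV. (cmod (x $ i))\<^sup>2) = 0"
    by (metis of_real_eq_0_iff)
  then have "\<forall>i. x $ i = 0" by (simp add: sum_nonneg_eq_0_iff)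
  then show False using assms(1) by (simp add: vec_eq_iff)
qed

text \<open>A nonzero common zero \<open>x\<close> of the orthogonality forms and the invariance
  equations of all components of \<open>f\<close> exists by counting. An element of the new span is
  \<open>t *s x + u\<close> with \<open>u\<close> in the old one, and invariance gives it the value
  \<open>f u = 0\<close>.\<close>

lemma extend_zero_subspace:
  fixes f :: "complex ^ 'n \<Rightarrow> complex ^ 'm"
  assumes f: "\<And>j. poly_deg_le d (\<lambda>x. f x $ j)"
    and B: "finite B" "\<And>w. w \<in> vec.span B \<Longrightarrow> f w = 0"
    and n: "card B + CARD('m) * (Suc (d + card B) choose d) < CARD('n)"
  shows "\<exists>x. x \<notin> vec.span B \<and> (\<forall>w\<in>vec.span (insert x B). f w = 0)"
proof -
  have "\<forall>j. \<exists>Q. finite Q \<and> card Q \<le> Suc (d + card B) choose Suc (card B) \<and>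
    (\<forall>q\<in>Q. \<exists>b>0. hom b q) \<and>
    (\<forall>x. (\<forall>q\<in>Q. q x = 0) \<longrightarrow> (\<forall>w\<in>vec.span B. f (x + w) $ j = f w $ j))"
    using invariance_conditions [OF B(1) f] by blast
  then obtain Q where Q: "\<And>j. finite (Q j)" "\<And>j. card (Q j) \<le> Suc (d + card B) choose Suc (card B)"
    "\<And>j q. q \<in> Q j \<Longrightarrow> \<exists>b>0. hom b q"
    "\<And>j x w. (\<forall>q\<in>Q j. q x = 0) \<Longrightarrow> w \<in> vec.span B \<Longrightarrow> f (x + w) $ j = f w $ j"
    by metis
  define H where "H = (\<lambda>v x. \<Sum>i\<in>UNIV. cnj (v $ i) * x $ i) ` B"
  define R where "R = H \<union> (\<Union>j. Q j)"
  have "card (\<Union>j. Q j) \<le> (\<Sum>j\<in>UNIV. card (Q j))" by (rule card_UN_le) simp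
  also have "\<dots> \<le> (\<Sum>j\<in>(UNIV :: 'm set). Suc (d + card B) choose d)"
    using Q(2) choose_swap [of "Suc (card B)" d] by (intro sum_mono) (simp add: add.commute)
  finally have "card (\<Union>j. Q j) \<le> CARD('m) * (Suc (d + card B) choose d)" by simp
  moreover have "card H \<le> card B" unfolding H_def by (rule card_image_le [OF B(1)])
  ultimately have "card R < CARD('n)"
    using card_Un_le [of H "\<Union>j. Q j"] n unfolding R_def by linarith
  moreover have "finite R" using B(1) Q(1) by (auto simp: R_def H_def)
  moreover have hom: "\<exists>b>0. hom b q" if "q \<in> R" for q
    using that Q(3) hom_hermitian_form by (auto simp: R_def H_def)
  ultimately obtain x where x: "x \<noteq> 0" "\<And>q. q \<in> R \<Longrightarrow> q x = 0"
    using homogeneous_common_zero [of R] by blast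
  have "x \<notin> vec.span B"
    using x by (intro orthogonal_notin_span) (auto simp: R_def H_def)
  moreover have "f w = 0" if w: "w \<in> vec.span (insert x B)" for w
  proof -
    obtain t where t: "w - t *s x \<in> vec.span B"
      using w vec.span_breakdown_eq by blast
    \<comment> \<open>Homogeneity passes the equations from \<open>x\<close> to its
      multiples.\<close>
    have "q (t *s x) = 0" if "q \<in> Q j" for q j
    proof -
      obtain b where "hom b q" using Q(3) \<open>q \<in> Q j\<close> by blast
      moreover have "q x = 0" using \<open>q \<in> Q j\<close> x(2) by (auto simp: R_def)
      ultimately show ?thesis by (simp add: hom_scaled_arg)
    qed
    then have "f (t *s x + (w - t *s x)) $ j = f (w - t *s x) $ j" for j
      using Q(4) t by blast
    then show ?thesis using B(2) [OF t] by (simp add: vec_eq_iff)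
  qed
  ultimately show ?thesis by blast
qed

(* "vec.subspace" and "vec.dim" are complex-linear on complex ^ 'n, unlike "subspace" and "dim".
   The hypothesis f 0 = 0 is necessary, since 0 lies in every linear subspace. *)
theorem theorem7:
  fixes d k :: nat and f :: "complex ^ 'n \<Rightarrow> complex ^ 'm"
  assumes "d > 0" and "k > 0"
    and "CARD('n) \<ge> n_bound d k CARD('m)"
    and "polynomial_map_degree_le d f"
    and "f 0 = 0"
  shows "\<exists>L :: (complex ^ 'n) set. vec.subspace L \<and> vec.dim L = k \<and> (\<forall>x\<in>L. f x = 0)"
proof -
  have f: "poly_deg_le d (\<lambda>x. f x $ j)" for j
    using assms(4) polynomial_fun_imp_poly_deg_le by (auto simp: polynomial_map_degree_le_def)
  have "\<exists>B. finite B \<and> card B = j \<and> vec.independent B \<and> (\<forall>w\<in>vec.span B. f w = 0)" if "j \<le> k" for j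
    using that
  proof (induction j)
    case 0
    show ?case using assms(5) vec.independent_empty by (intro exI [of _ "{}"]) simp
  next
    case (Suc j)
    then obtain B where B: "finite B" "card B = j" "vec.independent B" "\<And>w. w \<in> vec.span B \<Longrightarrow> f w = 0"
      by auto
    \<comment> \<open>Since \<open>j < k\<close>, the binomial is at most the one in
      \<open>n_bound\<close>, and the summand \<open>j < k\<close> makes the count strictly less
      than the number of variables.\<close>
    have "CARD('m) * (Suc (d + j) choose d) \<le> CARD('m) * ((d + k) choose d)"
      using Suc.prems by (intro mult_left_mono binomial_right_mono) auto
    then have "j + CARD('m) * (Suc (d + j) choose d) < CARD('n)"
      using assms(3) Suc.prems unfolding n_bound_def by linarith
    then have "card B + CARD('m) * (Suc (d + card B) choose d) < CARD('n)"
      by (simp only: B(2))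
    then obtain x where x: "x \<notin> vec.span B" "\<forall>w\<in>vec.span (insert x B). f w = 0"
      using extend_zero_subspace [OF f B(1,4)] by blast
    then have "x \<notin> B" using vec.span_base by blast
    then have "card (insert x B) = Suc j" using B(1,2) by simp
    moreover have "vec.independent (insert x B)" by (rule vec.independent_insertI [OF x(1) B(3)])
    ultimately show ?case using B(1) x(2) by (intro exI [of _ "insert x B"]) simp
  qed
  then obtain B where "card B = k" "vec.independent B" "\<forall>w\<in>vec.span B. f w = 0" by blast
  then show ?thesis
    by (intro exI [of _ "vec.span B"]) (auto simp: vec.dim_eq_card_independent)
qed

end
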